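(* Every infinite Valdivia compactum $K$ contains a non-trivial convergent sequence: there exist a sequence $(a_n)_{n<\omega}$ of points of $K$ that is not eventually constant and a point $a\in K$ such that $a_n\to a$.
   Context: For a set $\Gamma$, $\Sigma(\Gamma)$ is the set of all vectors in $\mathbb{R}^\Gamma$ (with the product topology) having at most countably many non-zero coordinates. A subset $A$ of a topological space $K$ is a $\Sigma$-subset of $K$ if there exist a set $\Gamma$ and a homeomorphic embedding (homeomorphism onto its image) $h:K\to\mathbb{R}^\Gamma$ such that $h[A]=h[K]\cap\Sigma(\Gamma)$. A Valdivia compactum is a compact space that contains a dense $\Sigma$-subset. A sequence $(a_n)$ converges to $a$ if every open neighbourhood of $a$ contains all but finitely many terms of the sequence. A sequence is trivial if it is eventually constant, and non-trivial otherwise. *)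

theory Defs
  imports "HOL-Analysis.Analysis"
begin

text \<open>
  \<open>\<real>\<^sup>\<Gamma>\<close> is the product topology over the index set \<open>\<Gamma>\<close>; its points are the functions that are
  \<open>undefined\<close> outside \<open>\<Gamma>\<close>, so only coordinates in \<open>\<Gamma>\<close> are counted.
\<close>

definition Sigma_product :: "'i set \<Rightarrow> ('i \<Rightarrow> real) set" where
  "Sigma_product \<Gamma> = {x \<in> \<Gamma> \<rightarrow>\<^sub>E UNIV. countable {\<gamma> \<in> \<Gamma>. x \<gamma> \<noteq> 0}}"

text \<open>
  HOL cannot quantify over types inside a formula, so the type from which the index set \<open>\<Gamma>\<close>
  is drawn is an explicit parameter. In a theorem with one of these predicates as a
  hypothesis and \<open>'i\<close> a free type variable, \<open>\<Gamma>\<close> ranges over arbitrary sets.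
\<close>

definition Sigma_subset :: "'i itself \<Rightarrow> 'a topology \<Rightarrow> 'a set \<Rightarrow> bool" where
  "Sigma_subset _ K A \<longleftrightarrow>
     A \<subseteq> topspace K \<and>
     (\<exists>(\<Gamma> :: 'i set) h.
        embedding_map K (product_topology (\<lambda>_. euclideanreal) \<Gamma>) h \<and>
        h ` A = h ` topspace K \<inter> Sigma_product \<Gamma>)"

text \<open>
  The Hausdorff property is not listed because it follows from the embedding into \<open>\<real>\<^sup>\<Gamma>\<close>.
\<close>

definition Valdivia_compactum :: "'i itself \<Rightarrow> 'a topology \<Rightarrow> bool" where
  "Valdivia_compactum I K \<longleftrightarrow>
     compact_space K \<and>
     (\<exists>A. Sigma_subset I K A \<and> K closure_of A = topspace K)"

definition trivial_sequence :: "(nat \<Rightarrow> 'a) \<Rightarrow> bool" where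
  "trivial_sequence a \<longleftrightarrow> (\<exists>c. \<forall>\<^sub>F n in sequentially. a n = c)"

end

theory Submission
  imports Defs
begin

text \<open>
  The points of a sequence in the \<open>\<Sigma>\<close>-product are supported in a common countable set of
  coordinates, and over that set the product is metrizable. So a compact subset of
  \<open>\<real>\<^sup>\<Gamma>\<close> contains the limit of a subsequence of every sequence of its points in the
  \<open>\<Sigma>\<close>-product. In an infinite Valdivia compactum the dense \<open>\<Sigma>\<close>-subset is infinite; apply this
  to a sequence of distinct points of it.
\<close>

text \<open>Once a metric inducing the topology is fixed, compactness and sequential compactness
  coincide.\<close>

lemma compact_imp_convergent_subsequence:
  assumes "metrizable_space X" and "compactin X S" and "range f \<subseteq> S"
  obtains l and r :: "nat \<Rightarrow> nat"
  where "l \<in> S" "strict_mono r" "limitin X (f \<circ> r) l sequentially"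
proof -
  obtain M d where "Metric_space M d" and X: "X = Metric_space.mtopology M d"
    using assms(1) unfolding metrizable_space_def by blast
  then interpret Metric_space M d by simp
  show thesis
    using assms that unfolding X compactin_sequentially by blast
qed

lemma Sigma_product_convergent_subsequence:
  fixes f :: "nat \<Rightarrow> 'i \<Rightarrow> real"
  defines "P \<equiv> product_topology (\<lambda>_. euclideanreal)"
  assumes S: "compactin (P \<Gamma>) S" and f: "range f \<subseteq> S \<inter> Sigma_product \<Gamma>"
  obtains l and r :: "nat \<Rightarrow> nat"
  where "l \<in> S" "strict_mono r" "limitin (P \<Gamma>) (f \<circ> r) l sequentially"
proof -
  \<comment> \<open>The union of the supports of all terms: countable, since each term has countable
    support.\<close>
  define C where "C = (\<Union>n. {\<gamma> \<in> \<Gamma>. f n \<gamma> \<noteq> 0})"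
  have "countable C" "C \<subseteq> \<Gamma>"
    using f by (auto simp: C_def Sigma_product_def image_subset_iff)
  have f0: "f n \<gamma> = 0" if "\<gamma> \<in> \<Gamma> - C" for n \<gamma>
    using that by (auto simp: C_def)
  have f_ext: "f n \<in> extensional \<Gamma>" for n
    using f by (auto simp: Sigma_product_def PiE_def image_subset_iff)
  have "metrizable_space (P C)"
    using \<open>countable C\<close> unfolding P_def
    by (auto simp: metrizable_space_product_topology metrizable_space_euclidean
        intro: countable_subset)
  \<comment> \<open>Restriction to \<open>C\<close> carries \<open>S\<close> to a compact set in the
    metrizable space \<open>P C\<close>, where a subsequence can be extracted.\<close>
  moreover have "continuous_map (P \<Gamma>) (P C) (\<lambda>x. restrict x C)"
    using \<open>C \<subseteq> \<Gamma>\<close> unfolding P_def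
    by (auto simp: continuous_map_componentwise intro!: continuous_map_product_projection)
  then have "compactin (P C) ((\<lambda>x. restrict x C) ` S)"
    using S image_compactin by blast
  moreover have "range (\<lambda>n. restrict (f n) C) \<subseteq> (\<lambda>x. restrict x C) ` S"
    using f by auto
  ultimately obtain k r where r: "strict_mono (r :: nat \<Rightarrow> nat)"
    and k: "limitin (P C) ((\<lambda>n. restrict (f n) C) \<circ> r) k sequentially"
    by (rule compact_imp_convergent_subsequence)
  \<comment> \<open>Off \<open>C\<close> every term is 0, so 0 is the only possible limit there. The
    outer \<open>restrict\<close> makes \<open>l\<close> extensional on \<Gamma>, as a point of the
    product must be.\<close>
  define l where "l = restrict (\<lambda>\<gamma>. if \<gamma> \<in> C then k \<gamma> else 0) \<Gamma>"
  have "limitin euclideanreal (\<lambda>n. (f \<circ> r) n \<gamma>) (l \<gamma>) sequentially" if "\<gamma> \<in> \<Gamma>" for \<gamma>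
  proof (cases "\<gamma> \<in> C")
    case True
    then show ?thesis
      using k that by (auto simp: P_def limitin_componentwise l_def)
  next
    case False
    then show ?thesis
      using that f0 by (simp add: l_def)
  qed
  then have lim: "limitin (P \<Gamma>) (f \<circ> r) l sequentially"
    using f_ext by (auto simp: P_def limitin_componentwise l_def PiE_def)
  \<comment> \<open>\<open>k\<close> is the restriction of some point of \<open>S\<close>, but that
    point may differ from \<open>l\<close> off \<open>C\<close>. Membership of \<open>l\<close> in
    \<open>S\<close> therefore comes from closedness: \<open>l\<close> is a limit of points of
    \<open>S\<close>, which is compact in a Hausdorff space.\<close>
  moreover have "closedin (P \<Gamma>) S"
    using S by (intro compactin_imp_closedin) (simp_all add: P_def Hausdorff_space_product_topology)
  then have "l \<in> S"
    using limitin_closedin [OF lim] f by (auto simp: image_subset_iff)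
  ultimately show thesis
    using r that by blast
qed

lemma nontrivial_sequence_if_inj:
  assumes "inj a"
  shows "\<not> trivial_sequence a"
proof
  assume "trivial_sequence a"
  then obtain c N where "\<And>n. n \<ge> N \<Longrightarrow> a n = c"
    unfolding trivial_sequence_def eventually_sequentially by blast
  then have "a N = a (Suc N)"
    by simp
  with assms show False
    by (simp add: inj_eq)
qed

theorem theorem2p8p10:
  fixes K :: "'a topology"
  assumes "Valdivia_compactum TYPE('i) K"
    and "infinite (topspace K)"
  shows "\<exists>(a :: nat \<Rightarrow> 'a) l. range a \<subseteq> topspace K \<and> l \<in> topspace K \<and>
           \<not> trivial_sequence a \<and> limitin K a l sequentially"
proof -
  obtain A \<Gamma> h where "compact_space K" and A: "A \<subseteq> topspace K" "K closure_of A = topspace K"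
    and emb: "embedding_map K (product_topology (\<lambda>_. euclideanreal) (\<Gamma> :: 'i set)) h"
    and hA: "h ` A = h ` topspace K \<inter> Sigma_product \<Gamma>"
    using assms(1) unfolding Valdivia_compactum_def Sigma_subset_def by blast
  define P where "P = product_topology (\<lambda>_. euclideanreal) \<Gamma>"
  define X where "X = subtopology P (h ` topspace K)"
  have hom: "homeomorphic_map K X h"
    using emb by (simp add: embedding_map_def X_def P_def)
  then obtain g where g: "homeomorphic_maps K X h g"
    by (auto simp: homeomorphic_map_maps)
  \<comment> \<open>The Hausdorff property passes from the real product to \<open>K\<close> through
    the embedding. It makes finite subsets of \<open>K\<close> closed, so a finite dense
    \<open>A\<close> would be all of the infinite space.\<close>
  have "Hausdorff_space P"
    by (simp add: P_def Hausdorff_space_product_topology)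
  then have "Hausdorff_space X"
    by (simp add: X_def Hausdorff_space_subtopology)
  then have "Hausdorff_space K"
    using hom homeomorphic_Hausdorff_space homeomorphic_map_imp_homeomorphic_space by blast
  have "infinite A"
  proof
    assume "finite A"
    then have "closedin K A"
      using A \<open>Hausdorff_space K\<close> closedin_Hausdorff_finite by blast
    then show False
      using A assms(2) \<open>finite A\<close> by (simp add: closure_of_closedin)
  qed
  then obtain s :: "nat \<Rightarrow> 'a" where s: "inj s" "range s \<subseteq> A"
    using infinite_countable_subset by blast
  then have s_in: "s n \<in> topspace K" for n
    using A by blast
  have "compactin P (h ` topspace K)"
  proof (rule image_compactin)
    show "compactin K (topspace K)"
      using \<open>compact_space K\<close> by (simp add: compact_space_def)
    show "continuous_map K P h"
      using hom homeomorphic_imp_continuous_map unfolding X_def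
      by (blast intro: continuous_map_into_fulltopology)
  qed
  moreover have "range (h \<circ> s) \<subseteq> h ` topspace K \<inter> Sigma_product \<Gamma>"
    using s(2) unfolding hA [symmetric] by auto
  ultimately obtain l r where l: "l \<in> h ` topspace K" and r: "strict_mono (r :: nat \<Rightarrow> nat)"
    and lim: "limitin P (h \<circ> s \<circ> r) l sequentially"
    unfolding P_def by (rule Sigma_product_convergent_subsequence)
  have gh: "g (h x) = x" if "x \<in> topspace K" for x
    using g that by (simp add: homeomorphic_maps_def)
  \<comment> \<open>The inverse \<open>g\<close> is continuous only on the image of
    \<open>h\<close>. As \<open>l\<close> and all terms lie in this image, the convergence also
    holds in the subspace \<open>X\<close>, and \<open>g\<close> carries it back to
    \<open>K\<close>.\<close>
  have "limitin X (h \<circ> s \<circ> r) l sequentially"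
    using lim l s_in unfolding X_def limitin_subtopology by simp
  moreover have "continuous_map X K g"
    using g by (simp add: homeomorphic_maps_def)
  ultimately have "limitin K (g \<circ> (h \<circ> s \<circ> r)) (g l) sequentially"
    by (intro continuous_map_limit)
  moreover have "g \<circ> (h \<circ> s \<circ> r) = s \<circ> r"
    using gh s_in by (simp add: fun_eq_iff)
  ultimately have "limitin K (s \<circ> r) (g l) sequentially"
    by simp
  moreover have "\<not> trivial_sequence (s \<circ> r)"
    using s r by (intro nontrivial_sequence_if_inj inj_compose strict_mono_imp_inj_on)
  moreover have "range (s \<circ> r) \<subseteq> topspace K"
    using s_in by auto
  ultimately show ?thesis
    by (intro exI [of _ "s \<circ> r"] exI [of _ "g l"] conjI limitin_topspace)
qed

end
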